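(* The family of tournaments ${\cal Q}_5$ is a sparse family. Hence, $t(n,U_5)=n(\log n)^{O(1)}$.
   Context: A tournament is a digraph having exactly one of the edges $(u,v),(v,u)$ for every pair of distinct vertices $u,v$. It is transitive if it has no directed cycle. $U_5$ is the tournament on $\{1,2,3,4,5\}$ obtained from the transitive tournament in which $(i,j)$ is an edge whenever $i<j$ by reversing the direction of the edges $(2,5)$ and $(1,4)$. For an odd integer $n$, $C_n$ is the tournament on vertices $\{1,\ldots,n\}$ in which $(i,j)$ is an edge if and only if $(j-i) \bmod n\in\{1,\ldots,(n-1)/2\}$. ${\cal Q}_5$ is the family of all tournaments $G=(V,E)$ satisfying at least one of the following: (1) $G$ is isomorphic to $C_n$ for some odd $n$; (2) $V$ can be partitioned into three sets $V_1,V_2,V_3$ so that for every $1\le i<j\le 3$ the tournament $G[V_i\cup V_j]$ induced on $V_i\cup V_j$ is transitive. A semi-complete digraph is a digraph in which every pair of distinct vertices is joined by at least one of the two possible edges; a pair $\{u,v\}$ is bidirectional if both $(u,v)$ and $(v,u)$ are edges. An undirected graph $U=(V,E)$ is a $d$-expander if for every $S\subseteq V$ of size $1\le |S|\le |V|/2$ there are at least $d|S|$ edges connecting $S$ to $V\setminus S$. A semi-complete digraph is a $d$-expander if the undirected graph on the same vertex set formed by its bidirectional pairs is a $d$-expander. For a semi-complete digraph $F$, ${\cal D}_F$ is the distribution over tournaments obtained from $F$ by picking independently and uniformly, for each bidirectional pair $\{i,j\}$ of $F$, either the edge $(i,j)$ or the edge $(j,i)$ (all other edges of $F$ are kept). A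 family of tournaments ${\cal Q}$ is sparse if there is a constant $b$ such that for every $n$-vertex semi-complete digraph $F$ which is a $b\log^b n$-expander, $\mathbb{P}_{G\sim{\cal D}_F}[G\in{\cal Q}]<1/2$. Here $\log^b n=(\log n)^b$. A digraph contains a copy of a tournament $H$ if it has a (not necessarily induced) subgraph isomorphic to $H$. For a tournament $H$ and $n\ge|V(H)|$, $t(n,H)$ is the smallest integer $t$ such that adding any $t$ new edges (reversals of existing edges) to any $n$-vertex tournament results in a digraph containing a copy of $H$. The asymptotics are for $n\to\infty$.
   Formalization: In the definition of sparse, n is at least 2: the one-vertex digraph is vacuously an expander and its only orientation is C_1, which lies in Q_5, so the literal claim fails at n=1. Logarithms are binary and vertices are natural numbers. *)

theory Defs
  imports
    "HOL-Probability.Probability"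
    "HOL-Library.Landau_Symbols"
    "Graph_Theory.Graph_Theory"
begin

section \<open>Tournaments and semi-complete digraphs\<close>

text \<open>\<open>pair_digraph\<close> means finite, loopless and without parallel arcs.\<close>

definition semicomplete :: "'a pair_pre_digraph \<Rightarrow> bool" where
  "semicomplete F \<longleftrightarrow> pair_digraph F \<and>
     (\<forall>u\<in>pverts F. \<forall>v\<in>pverts F. u \<noteq> v \<longrightarrow> (u, v) \<in> parcs F \<or> (v, u) \<in> parcs F)"

definition tournament :: "'a pair_pre_digraph \<Rightarrow> bool" where
  "tournament G \<longleftrightarrow> pair_digraph G \<and>
     (\<forall>u\<in>pverts G. \<forall>v\<in>pverts G. u \<noteq> v \<longrightarrow> ((u, v) \<in> parcs G \<longleftrightarrow> (v, u) \<notin> parcs G))"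

definition transitive_digraph :: "('a, 'b) pre_digraph \<Rightarrow> bool" where
  "transitive_digraph G \<longleftrightarrow> \<not> (\<exists>p. pre_digraph.cycle G p)"

definition U5 :: "nat pair_pre_digraph" where
  "U5 = \<lparr> pverts = {1..5},
          parcs = ({(i, j). i \<in> {1..5} \<and> j \<in> {1..5} \<and> i < j} - {(2, 5), (1, 4)})
                  \<union> {(5, 2), (4, 1)} \<rparr>"

definition circular_tournament :: "nat \<Rightarrow> nat pair_pre_digraph" where
  "circular_tournament n = \<lparr> pverts = {1..n},
     parcs = {(i, j). i \<in> {1..n} \<and> j \<in> {1..n} \<and>
                (int j - int i) mod int n \<in> {1..(int n - 1) div 2}} \<rparr>"

text \<open>The parts of a partition are allowed to be empty, so that all transitive tournaments belong
  to the family, also those with fewer than three vertices.\<close>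

definition Q5 :: "'a pair_pre_digraph set" where
  "Q5 = {G. tournament G \<and>
     ((\<exists>n. odd n \<and> digraph_iso (with_proj G) (with_proj (circular_tournament n))) \<or>
      (\<exists>V :: nat \<Rightarrow> 'a set.
         pverts G = V 1 \<union> V 2 \<union> V 3 \<and>
         disjoint_family_on V {1..3} \<and>
         (\<forall>i j. 1 \<le> i \<and> i < j \<and> j \<le> 3 \<longrightarrow>
            transitive_digraph (with_proj G \<restriction> (V i \<union> V j)))))}"


section \<open>Expanders, random orientations, sparse families\<close>

definition is_expander :: "real \<Rightarrow> 'a set \<Rightarrow> 'a set set \<Rightarrow> bool" where
  "is_expander d V E \<longleftrightarrow>
     (\<forall>S\<subseteq>V. 1 \<le> card S \<and> real (card S) \<le> real (card V) / 2 \<longrightarrow>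
        d * real (card S) \<le> real (card {e \<in> E. \<exists>u\<in>S. \<exists>v\<in>V - S. e = {u, v}}))"

definition bidirectional_pairs :: "'a pair_pre_digraph \<Rightarrow> 'a set set" where
  "bidirectional_pairs F = {{u, v} |u v. u \<noteq> v \<and> (u, v) \<in> parcs F \<and> (v, u) \<in> parcs F}"

definition semicomplete_expander :: "real \<Rightarrow> 'a pair_pre_digraph \<Rightarrow> bool" where
  "semicomplete_expander d F \<longleftrightarrow>
     semicomplete F \<and> is_expander d (pverts F) (bidirectional_pairs F)"

text \<open>The random choice function \<open>c\<close> maps each bidirectional pair \<open>{u, v}\<close> independently to one of
  \<open>(u, v)\<close> and \<open>(v, u)\<close>, each with probability 1/2.\<close>

definition random_tournament :: "'a pair_pre_digraph \<Rightarrow> 'a pair_pre_digraph pmf" where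
  "random_tournament F =
     map_pmf (\<lambda>c. \<lparr> pverts = pverts F,
                    parcs = {(u, v). (u, v) \<in> parcs F \<and> {u, v} \<notin> bidirectional_pairs F}
                            \<union> c ` bidirectional_pairs F \<rparr>)
       (Pi_pmf (bidirectional_pairs F) undefined (\<lambda>e. pmf_of_set {(u, v). {u, v} = e}))"

text \<open>Logarithms are binary. The one-vertex digraph is vacuously a \<open>d\<close>-expander for every \<open>d\<close>
  (and has only one orientation), so it has to be excluded; for \<open>n \<ge> 2\<close> no further restriction
  to large \<open>n\<close> is needed, since increasing \<open>b\<close> rules out any finite number of values of \<open>n\<close>.\<close>

definition sparse_family :: "'a pair_pre_digraph set \<Rightarrow> bool" where
  "sparse_family Q \<longleftrightarrow>
     (\<exists>b::real. \<forall>n\<ge>2. \<forall>F. card (pverts F) = n \<and>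
        semicomplete_expander (b * log 2 (real n) powr b) F \<longrightarrow>
        measure_pmf.prob (random_tournament F) Q < 1 / 2)"


section \<open>The extremal function\<close>

definition contains_copy :: "'a pair_pre_digraph \<Rightarrow> 'b pair_pre_digraph \<Rightarrow> bool" where
  "contains_copy D H \<longleftrightarrow>
     (\<exists>S :: 'a pair_pre_digraph.
        subgraph (with_proj S) (with_proj D) \<and> digraph_iso (with_proj S) (with_proj H))"

text \<open>Vertices are natural numbers without loss of generality: every finite digraph is isomorphic
  to one with such vertices.\<close>

definition t_min :: "nat \<Rightarrow> 'b pair_pre_digraph \<Rightarrow> nat" where
  "t_min n H = (LEAST t. \<forall>T :: nat pair_pre_digraph. tournament T \<and> card (pverts T) = n \<longrightarrow>
     (\<forall>R. R \<subseteq> (parcs T)\<inverse> \<and> card R = t \<longrightarrow>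
        contains_copy (T\<lparr>parcs := parcs T \<union> R\<rparr>) H))"

end

theory Submission
  imports Defs
begin

text \<open>
  The tournaments of \<open>Q5\<close> on \<open>n\<close> labelled vertices are determined by \<open>O(n log n)\<close> bits (a cyclic
  numbering, or a partition and the ranks in three transitive tournaments), whereas a \<open>d\<close>-expander has
  minimum degree at least \<open>d\<close> and hence at least \<open>2\<^bsup>dn/2\<^esup>\<close> orientations. So \<open>Q5\<close> is sparse.

  For the extremal function no structure theorem for \<open>U5\<close>-free tournaments is needed; in fact
  \<open>n \<le> t(n, U5) \<le> 5n + 1\<close>. The lower bound reverses the edges at the source of a transitive tournament,
  since deleting any vertex from \<open>U5\<close> leaves a directed triangle.
  For the upper bound, suppose that a \<open>U5\<close>-free semi-complete digraph has more than \<open>5n\<close> bidirectional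
  pairs, and pass to a subset in which each vertex has at least six bidirectional neighbours.
  Let \<open>N v\<close> be the set of bidirectional neighbours of \<open>v\<close>. Then \<open>N v\<close> is linearly ordered, and every other
  vertex falls into a gap of this order. An inner gap is a module up to two exceptional vertices, so a vertex
  \<open>u\<close> in it has all its bidirectional neighbours in the gap or among the exceptions, and so do the inner gaps
  of \<open>u\<close>. The latter avoid the neighbours of \<open>u\<close> and are therefore smaller, which contradicts the choice of
  a smallest inner gap.
\<close>

section \<open>Bidirectional pairs in digraphs without \<open>U5\<close>\<close>

text \<open>The ten arcs required among \<open>p1\<close>, ..., \<open>p5\<close> are those of
  \<open>U5\<close>. Working with a relation that may hold in both directions makes it easy to
  reverse all arcs or to restrict to a subset.\<close>

locale U5_free =
  fixes V :: "'a set" and a :: "'a \<Rightarrow> 'a \<Rightarrow> bool"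
  assumes finite_V: "finite V"
    and irrefl: "\<not> a u u"
    and semicomplete: "\<lbrakk>u \<in> V; v \<in> V; u \<noteq> v\<rbrakk> \<Longrightarrow> a u v \<or> a v u"
    and no_U5: "\<lbrakk>p1 \<in> V; p2 \<in> V; p3 \<in> V; p4 \<in> V; p5 \<in> V; a p1 p2; a p1 p3; a p1 p5; a p2 p3; a p2 p4;
      a p3 p4; a p3 p5; a p4 p5; a p5 p2; a p4 p1\<rbrakk> \<Longrightarrow> False"
begin

text \<open>\<open>U5\<close> is isomorphic to its converse via \<open>i\<close> to
  \<open>6 - i\<close>, so local statements come with mirror images.\<close>

lemma U5_free_converse: "U5_free V (\<lambda>u v. a v u)"
proof
  fix p1 p2 p3 p4 p5
  assume "p1 \<in> V" "p2 \<in> V" "p3 \<in> V" "p4 \<in> V" "p5 \<in> V" "a p2 p1" "a p3 p1" "a p5 p1" "a p3 p2" "a p4 p2"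
    "a p4 p3" "a p5 p3" "a p5 p4" "a p2 p5" "a p1 p4"
  then show False using no_U5[of p5 p4 p3 p2 p1] by blast
qed (use finite_V irrefl semicomplete in auto)

section \<open>Directed triangles meeting a bidirectional neighbourhood\<close>

definition N :: "'a \<Rightarrow> 'a set" where
  "N v = {w \<in> V. a v w \<and> a w v}"

lemma in_N: "x \<in> N v \<longleftrightarrow> x \<in> V \<and> a v x \<and> a x v"
  by (auto simp: N_def)

lemma finite_N: "finite (N v)"
  using finite_V by (simp add: N_def)

text \<open>Since \<open>v\<close> is joined in both directions to \<open>x\<close>,
  \<open>y\<close>, \<open>z\<close>, its arcs there fit any pattern. Whatever the directions of the
  remaining arcs at \<open>w\<close>, one of eight embeddings puts \<open>U5\<close> on these five
  vertices.\<close>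

lemma transitive_triple_no_triangle:
  assumes V: "v \<in> V" "w \<in> V" and N: "x \<in> N v" "y \<in> N v" "z \<in> N v"
    and w: "w \<noteq> v" "w \<noteq> x" "w \<noteq> y" "w \<noteq> z"
    and t: "a x y" "a y z" "a x z"
  shows "\<not> (a y w \<and> a w x)" "\<not> (a z w \<and> a w y)" "\<not> (a z w \<and> a w x)"
proof -
  have c: "a x w \<or> a w x" "a y w \<or> a w y" "a z w \<or> a w z" "a v w \<or> a w v"
    using semicomplete V N w by (auto simp: in_N)
  note u = no_U5[of x y z w v] no_U5[of v x y z w] no_U5[of x v y w z] no_U5[of w v x y z]
    no_U5[of x y z v w] no_U5[of x w y v z] no_U5[of x z v w y] no_U5[of w x y z v]
  show "\<not> (a y w \<and> a w x)" "\<not> (a z w \<and> a w y)" "\<not> (a z w \<and> a w x)"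
    using V N t c u by (auto simp: in_N)
qed

text \<open>A triangle with \<open>w\<close> different from \<open>v\<close> would force every other
  vertex of \<open>N v\<close> to close a directed triangle with the arc from \<open>x\<close> to
  \<open>y\<close>. Of two such vertices let \<open>p\<close> have an arc to \<open>q\<close>; then
  \<open>p\<close>, \<open>q\<close>, \<open>x\<close> is a transitive triple, and \<open>y\<close>
  closes a directed triangle with its first and last member, which is impossible. This is what makes
  \<open>N v\<close> linearly ordered.\<close>

lemma arc_in_N_no_triangle:
  assumes d: "card (N v) \<ge> 4" and V: "v \<in> V" "w \<in> V" and N: "x \<in> N v" "y \<in> N v"
    and t: "a x y" "a y w" "a w x"
  shows "w = v"
proof (rule ccontr)
  assume wv: "w \<noteq> v"
  have ne: "x \<noteq> y" "w \<noteq> x" "w \<noteq> y" using t irrefl by auto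
  \<comment> \<open>Otherwise \<open>x\<close>, \<open>y\<close>, \<open>z\<close> form a transitive
    triple in one of three orders, and \<open>w\<close> closes a triangle with two of its
    members.\<close>
  have pq: "a y z \<and> a z x" if z: "z \<in> N v" "z \<noteq> x" "z \<noteq> y" for z
  proof (cases "z = w")
    case False
    have "a x z \<or> a z x" "a y z \<or> a z y" using semicomplete N z by (auto simp: in_N)
    moreover have "\<not> (a z x \<and> a z y)" "\<not> (a x z \<and> a z y)" "\<not> (a x z \<and> a y z)"
      using transitive_triple_no_triangle[OF V z(1) N wv]
        transitive_triple_no_triangle[OF V N(1) z(1) N(2) wv]
        transitive_triple_no_triangle[OF V N z(1) wv] ne False t z by auto
    ultimately show ?thesis by blast
  qed (use t in simp)
  have "\<not> N v \<subseteq> {x, y, p}" for p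
  proof
    assume "N v \<subseteq> {x, y, p}"
    then have "card (N v) \<le> card {x, y, p}" by (intro card_mono) auto
    also have "\<dots> \<le> 3" by (simp add: card_insert_if)
    finally show False using d by linarith
  qed
  then obtain p where p: "p \<in> N v" "p \<noteq> x" "p \<noteq> y" by blast
  from \<open>\<not> N v \<subseteq> {x, y, p}\<close> obtain q where q: "q \<in> N v" "q \<noteq> x" "q \<noteq> y" "q \<noteq> p" by blast
  have False if "p \<in> N v" "p \<noteq> x" "p \<noteq> y" "q \<in> N v" "q \<noteq> x" "q \<noteq> y" "a p q" for p q
  proof -
    have "p \<noteq> q" using that irrefl by auto
    moreover have "y \<noteq> v" "y \<in> V" using N irrefl by (auto simp: in_N)
    ultimately show False
      using transitive_triple_no_triangle(3)[OF V(1) _ that(1,4) N(1), of y] pq[of p] pq[of q] that t(1) ne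
      by auto
  qed
  moreover have "a p q \<or> a q p" using semicomplete p q by (auto simp: in_N)
  ultimately show False using p q by blast
qed

section \<open>Positions of outside vertices relative to the neighbourhood\<close>

text \<open>For \<open>w\<close> outside \<open>insert v (N v)\<close> this is an initial segment of
  the order on \<open>N v\<close> (when that has at least four vertices), so it marks the position
  of \<open>w\<close>.\<close>

definition L :: "'a \<Rightarrow> 'a \<Rightarrow> 'a set" where
  "L v w = {x \<in> N v. a x w}"

lemma in_L: "x \<in> L v w \<longleftrightarrow> x \<in> N v \<and> a x w"
  by (simp add: L_def)

lemma finite_L: "finite (L v w)"
  using finite_N by (simp add: L_def)

lemma L_subset: "L v w \<subseteq> N v"
  by (auto simp: L_def)

text \<open>Here \<open>w1\<close> comes before \<open>x\<close> and \<open>w2\<close> after it, yet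
  there is a backward arc from \<open>w2\<close> to \<open>w1\<close>, while \<open>y\<close>
  precedes all three. Every choice of arcs at \<open>v\<close> other than the two leaving
  \<open>v\<close> then yields \<open>U5\<close>.\<close>

lemma separated_triangle:
  assumes d: "card (N v) \<ge> 4" and V: "v \<in> V" "w1 \<in> V" "w2 \<in> V" "w1 \<noteq> v" "w2 \<noteq> v"
    and N: "x \<in> N v" "y \<in> N v" "y \<noteq> x"
    and t: "a y w1" "a w1 x" "a x w2" "a w2 w1"
  shows "\<not> a w1 v \<and> \<not> a w2 v"
proof -
  have xV: "x \<in> V" "y \<in> V" "x \<noteq> v" using N irrefl by (auto simp: in_N)
  have "\<not> a x y" using arc_in_N_no_triangle[OF d V(1,2) N(1,2)] t V by blast
  then have yx: "a y x" using semicomplete xV N by blast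
  have "\<not> a w2 y" using arc_in_N_no_triangle[OF d V(1,3) N(2,1) yx t(3)] V by blast
  then have yw2: "a y w2" using semicomplete xV V t \<open>\<not> a x y\<close> by blast
  have c: "a w1 v \<or> a v w1" "a w2 v \<or> a v w2" using semicomplete V by auto
  have v: "a v x" "a x v" "a v y" "a y v" using N by (auto simp: in_N)
  show ?thesis
    using c no_U5[of y w1 x v w2] no_U5[of y w2 w1 v x] no_U5[of y x w2 v w1] V(1-3) xV v t yx yw2
    by auto
qed

lemma N_converse: "U5_free.N V (\<lambda>u v. a v u) v = N v"
  using U5_free.N_def[OF U5_free_converse] by (auto simp: N_def)

lemma separated_triangle_converse:
  assumes d: "card (N v) \<ge> 4" and V: "v \<in> V" "w1 \<in> V" "w2 \<in> V" "w1 \<noteq> v" "w2 \<noteq> v"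
    and N: "x \<in> N v" "z \<in> N v" "z \<noteq> x"
    and t: "a w2 z" "a w1 x" "a x w2" "a w2 w1"
  shows "\<not> a v w1 \<and> \<not> a v w2"
  using U5_free.separated_triangle[OF U5_free_converse, unfolded N_converse, of v w2 w1 x z] assms by blast

text \<open>A second separating vertex replaces the outer one. The arc between \<open>x\<close> and
  \<open>y\<close> may go either way, as the embeddings are symmetric in the two.\<close>

lemma doubly_separated_triangle:
  assumes V: "v \<in> V" "w1 \<in> V" "w2 \<in> V" "w1 \<noteq> v" "w2 \<noteq> v"
    and N: "x \<in> N v" "y \<in> N v" "y \<noteq> x"
    and t: "a w1 x" "a x w2" "a w1 y" "a y w2" "a w2 w1"
  shows "\<not> (a w1 v \<and> a w2 v)" "\<not> (a v w1 \<and> a v w2)"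
proof -
  have xV: "x \<in> V" "y \<in> V" using N irrefl by (auto simp: in_N)
  have xy: "a x y \<or> a y x" using semicomplete xV N by blast
  have v: "a v x" "a x v" "a v y" "a y v" using N by (auto simp: in_N)
  show "\<not> (a w1 v \<and> a w2 v)" "\<not> (a v w1 \<and> a v w2)"
    using xy no_U5[of w1 x y w2 v] no_U5[of w1 y x w2 v] no_U5[of v w1 x y w2] no_U5[of v w1 y x w2]
      V(1-3) xV v t by auto
qed

text \<open>An outer vertex below excludes arcs from \<open>w1\<close>, \<open>w2\<close> to
  \<open>v\<close>, one above excludes arcs from \<open>v\<close> to them, and a second separator
  \<open>y\<close> excludes that both arcs at \<open>v\<close> point the same way. The assumption
  \<open>outer\<close> provides at least two of these three, one of them from an outer vertex, which
  leaves no direction for the arcs at \<open>v\<close>.\<close>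

lemma separated_strict:
  assumes d: "card (N v) \<ge> 4" and V: "v \<in> V" "w1 \<in> V" "w2 \<in> V" "w1 \<notin> insert v (N v)" "w2 \<notin> insert v (N v)"
    and x: "x \<in> L v w2 - L v w1"
    and outer: "L v w1 \<noteq> {} \<or> y \<in> L v w2 - L v w1 \<and> y \<noteq> x" "L v w2 \<noteq> N v \<or> y \<in> L v w2 - L v w1 \<and> y \<noteq> x"
       "L v w1 \<noteq> {} \<or> L v w2 \<noteq> N v"
  shows "\<not> a w2 w1"
proof
  assume t: "a w2 w1"
  have dir: "a w z" if "w \<in> {w1, w2}" "z \<in> N v" "z \<notin> L v w" for w z
    using that semicomplete V by (auto simp: in_L in_N)
  have w: "w1 \<noteq> v" "w2 \<noteq> v" using V by auto
  have c: "a w1 v \<or> a v w1" "a w2 v \<or> a v w2" using semicomplete V w by auto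
  have xN: "x \<in> N v" "a w1 x" "a x w2" using x dir[of w1 x] by (auto simp: in_L)
  have 1: "\<not> a w1 v \<and> \<not> a w2 v" if "L v w1 \<noteq> {}"
  proof -
    from that obtain p where p: "p \<in> N v" "a p w1" by (auto simp: in_L)
    with x have "p \<noteq> x" by (auto simp: in_L)
    then show ?thesis using separated_triangle[OF d V(1-3) w xN(1) p(1) _ p(2) xN(2,3) t] by blast
  qed
  have 2: "\<not> a v w1 \<and> \<not> a v w2" if "L v w2 \<noteq> N v"
  proof -
    from that obtain p where p: "p \<in> N v" "p \<notin> L v w2" using L_subset by blast
    with x have "p \<noteq> x" by blast
    then show ?thesis using separated_triangle_converse[OF d V(1-3) w xN(1) p(1) _ dir[OF _ p] xN(2,3) t] by blast
  qed
  have 3: "\<not> (a w1 v \<and> a w2 v)" "\<not> (a v w1 \<and> a v w2)" if "y \<in> L v w2 - L v w1" "y \<noteq> x"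
    using doubly_separated_triangle[OF V(1-3) w xN(1) _ that(2) xN(2,3) dir[of w1 y] _ t] that
    by (auto simp: in_L)
  show False using 1 2 3 c outer by blast
qed

text \<open>For \<open>x\<close> and \<open>y\<close> witnessing incomparability, the arc between
  them closes a directed triangle with \<open>w1\<close> or \<open>w2\<close>.\<close>

lemma L_chain:
  assumes d: "card (N v) \<ge> 4" and V: "v \<in> V" "w1 \<in> V" "w2 \<in> V" "w1 \<notin> insert v (N v)" "w2 \<notin> insert v (N v)"
  shows "L v w1 \<subseteq> L v w2 \<or> L v w2 \<subseteq> L v w1"
proof (rule ccontr)
  assume "\<not> ?thesis"
  then obtain x y where xy: "x \<in> N v" "y \<in> N v" "a x w1" "\<not> a x w2" "a y w2" "\<not> a y w1"
    unfolding subset_iff in_L by blast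
  then have "a w2 x" "a w1 y" "x \<noteq> y" using V semicomplete by (auto simp: in_N)
  moreover have "a x y \<or> a y x" using semicomplete xy \<open>x \<noteq> y\<close> by (auto simp: in_N)
  ultimately show False
    using arc_in_N_no_triangle[OF d V(1,2) xy(2,1)] arc_in_N_no_triangle[OF d V(1,3) xy(1,2)] xy V
    by blast
qed

section \<open>Gaps of the linear order\<close>

text \<open>Because the sets \<open>L v w\<close> form a chain, equal cardinality means equal sets:
  these are the vertices that fall just behind the first \<open>k\<close> members of
  \<open>N v\<close>.\<close>

definition gap :: "'a \<Rightarrow> nat \<Rightarrow> 'a set" where
  "gap v k = {w \<in> V - insert v (N v). card (L v w) = k}"

text \<open>The exceptions are \<open>v\<close> and at most one vertex of the initial segment below
  the gap. Two vertices of \<open>N v\<close> on each side of the gap guarantee a second separator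
  when the position of \<open>z\<close> is extreme and an outer vertex is missing.\<close>

lemma gap_near_module:
  assumes v: "v \<in> V" and k: "2 \<le> k" "k + 2 \<le> card (N v)"
  shows "\<exists>E. finite E \<and> card E \<le> 2 \<and>
    (\<forall>z\<in>V - gap v k - E. (\<forall>u\<in>gap v k. \<not> a u z) \<or> (\<forall>u\<in>gap v k. \<not> a z u))"
proof (cases "gap v k = {}")
  case True
  then show ?thesis by (intro exI[of _ "{}"]) auto
next
  case False
  have d: "card (N v) \<ge> 4" using k by linarith
  from False obtain u0 where u0: "u0 \<in> gap v k" by blast
  define A where "A = L v u0"
  have cA: "card A = k" "finite A" "A \<subseteq> N v" using u0 finite_L L_subset by (auto simp: gap_def A_def)
  have LA: "L v u = A" if "u \<in> gap v k" for u
  proof -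
    have "L v u \<subseteq> A \<or> A \<subseteq> L v u" "card (L v u) = k"
      using L_chain[OF d v, of u u0] u0 that by (auto simp: gap_def A_def)
    then show ?thesis using card_subset_eq[of A "L v u"] card_subset_eq[of "L v u" A] cA finite_L by metis
  qed
  \<comment> \<open>All of \<open>A\<close> has arcs into the whole gap; \<open>Z\<close> collects
    the vertices that also receive one. An arc of \<open>Z\<close> from \<open>x\<close> to
    \<open>y\<close> would close a directed triangle with a gap vertex that has an arc to
    \<open>x\<close>.\<close>
  define Z where "Z = {z \<in> A. \<exists>u\<in>gap v k. a u z}"
  have "x = y" if "x \<in> Z" "y \<in> Z" for x y
  proof (rule ccontr)
    assume ne: "x \<noteq> y"
    have f: False if "x \<in> Z" "y \<in> Z" "a x y" for x y
    proof -
      obtain u where u: "u \<in> gap v k" "a u x" using \<open>x \<in> Z\<close> by (auto simp: Z_def)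
      have "y \<in> L v u" "x \<in> N v" using that LA[OF u(1)] cA by (auto simp: Z_def)
      then show False
        using arc_in_N_no_triangle[OF d v, of u x y] u that by (auto simp: gap_def in_L)
    qed
    have "x \<in> V" "y \<in> V" using that cA by (auto simp: Z_def in_N)
    then show False using f that semicomplete ne by blast
  qed
  then have "card Z \<le> 1" using cA by (simp add: Z_def card_le_Suc0_iff_eq)
  then have "card (insert v Z) \<le> 2" using card_insert_le_m1[of 2 Z v] by simp
  moreover have "(\<forall>u\<in>gap v k. \<not> a u z) \<or> (\<forall>u\<in>gap v k. \<not> a z u)" if z: "z \<in> V - gap v k - insert v Z" for z
  proof (cases "z \<in> N v")
    case True
    show ?thesis
    proof (cases "z \<in> A")
      case True
      then show ?thesis using z by (auto simp: Z_def)
    next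
      case False
      then have "\<not> a z u" if "u \<in> gap v k" for u using LA[OF that] True by (auto simp: L_def)
      then show ?thesis by blast
    qed
  next
    case zN: False
    then have ne: "L v z \<noteq> A" using z cA by (auto simp: gap_def)
    have zv: "z \<in> V" "z \<notin> insert v (N v)" using z zN by auto
    have gV: "u \<in> V" "u \<notin> insert v (N v)" if "u \<in> gap v k" for u using that by (auto simp: gap_def)
    have two: "\<exists>x y. x \<in> S \<and> y \<in> S \<and> y \<noteq> x" if "card S \<ge> 2" for S :: "'a set"
      using that by (metis card_2_iff' obtain_subset_with_card_n subsetD)
    consider "L v z \<subset> A" | "A \<subset> L v z" using L_chain[OF d v zv(1) gV(1)[OF u0] zv(2) gV(2)[OF u0]] ne
      by (auto simp: A_def)
    then show ?thesis
    proof cases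
      case 1
      have "\<not> a u z" if u: "u \<in> gap v k" for u
      proof -
        have AN: "A \<noteq> N v" using cA k by auto
        obtain x where x: "x \<in> A - L v z" using 1 by blast
        \<comment> \<open>If \<open>L v z\<close> is empty, all of \<open>A\<close> separates
          \<open>z\<close> from the gap, and \<open>A\<close> has at least two vertices.\<close>
        have "\<exists>y. L v z \<noteq> {} \<or> y \<in> A - L v z \<and> y \<noteq> x" using two[of A] cA k by auto
        then show ?thesis
          using separated_strict[OF d v zv(1) gV(1)[OF u] zv(2) gV(2)[OF u]] x AN LA[OF u] by auto
      qed
      then show ?thesis by blast
    next
      case 2
      have "\<not> a z u" if u: "u \<in> gap v k" for u
      proof -
        have AN: "A \<noteq> {}" using cA k by auto
        obtain x where x: "x \<in> L v z - A" using 2 by blast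
        have "card (N v - A) \<ge> 2" using cA k by (simp add: card_Diff_subset)
        then have "\<exists>y. L v z \<noteq> N v \<or> y \<in> L v z - A \<and> y \<noteq> x" using two[of "N v - A"] by (cases "L v z = N v") auto
        then show ?thesis
          using separated_strict[OF d v gV(1)[OF u] zv(1) gV(2)[OF u] zv(2)] x AN LA[OF u] by auto
      qed
      then show ?thesis by blast
    qed
  qed
  ultimately show ?thesis using cA by (intro exI[of _ "insert v Z"]) (auto simp: Z_def)
qed

section \<open>Existence of a vertex with few bidirectional neighbours\<close>

lemma finite_gap: "finite (gap v k)"
  using finite_V by (simp add: gap_def)

text \<open>Take a vertex \<open>s\<close> of maximal out-degree in \<open>S\<close>. If some
  \<open>y\<close> were not beaten by \<open>s\<close>, the absence of triangles would make
  \<open>y\<close> beat everything that \<open>s\<close> beats, and \<open>s\<close> as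
  well.\<close>

lemma source_exists:
  assumes d: "card (N v) \<ge> 4" and v: "v \<in> V" and S: "S \<subseteq> N v" "S \<noteq> {}"
  shows "\<exists>s\<in>S. \<forall>y\<in>S - {s}. a s y"
proof -
  have fin: "finite S" using S finite_N finite_subset by blast
  define out where "out s = card {y \<in> S. a s y}" for s
  have "Max (out ` S) \<in> out ` S" using fin S by (intro Max_in) auto
  then obtain s where s: "s \<in> S" "out s = Max (out ` S)" by auto
  have "a s y" if y: "y \<in> S" "y \<noteq> s" for y
  proof (rule ccontr)
    assume "\<not> a s y"
    then have ys: "a y s" using semicomplete[of s y] s y S by (auto simp: in_N subset_iff)
    have "a y z" if "z \<in> S" "a s z" for z
    proof (rule ccontr)
      assume z: "\<not> a y z"
      then have "a z y" using semicomplete[of z y] that y S \<open>\<not> a s y\<close>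
        by (auto simp: in_N subset_iff)
      moreover have "s \<in> N v" "z \<in> N v" "y \<in> V" "y \<noteq> v" using s y S that irrefl by (auto simp: in_N)
      ultimately show False using arc_in_N_no_triangle[OF d v, of y s z] that ys by blast
    qed
    then have "{z \<in> S. a s z} \<subset> {z \<in> S. a y z}" using s ys irrefl by blast
    then have "out s < out y" unfolding out_def using fin by (intro psubset_card_mono) auto
    moreover have "out y \<le> Max (out ` S)" using fin y by simp
    ultimately show False using s by simp
  qed
  then show ?thesis using s by blast
qed

text \<open>Let \<open>x\<close> be the third vertex of \<open>N v\<close>. At most one of its
  bidirectional neighbours lies in \<open>N v\<close> and one is \<open>v\<close>, so a third one,
  \<open>w\<close>, lies outside. Being joined to \<open>x\<close> in both directions puts
  \<open>w\<close> directly behind \<open>x\<close>.\<close>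

lemma gap_nonempty:
  assumes v: "v \<in> V" and dv: "card (N v) \<ge> 6" and deg: "\<And>x. x \<in> V \<Longrightarrow> card (N x) \<ge> 3"
  shows "gap v 3 \<noteq> {}"
proof -
  have d: "card (N v) \<ge> 4" using dv by linarith
  have ne: "N v - S \<noteq> {}" if "card S \<le> 2" "finite S" for S
    using card_mono[of S "N v"] that dv by auto
  obtain s1 where s1: "s1 \<in> N v" "\<And>y. y \<in> N v \<Longrightarrow> y \<noteq> s1 \<Longrightarrow> a s1 y"
    using source_exists[OF d v, of "N v"] ne[of "{}"] by auto
  obtain s2 where s2: "s2 \<in> N v" "s2 \<noteq> s1" "\<And>y. y \<in> N v \<Longrightarrow> y \<noteq> s1 \<Longrightarrow> y \<noteq> s2 \<Longrightarrow> a s2 y"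
    using source_exists[OF d v, of "N v - {s1}"] ne[of "{s1}"] by auto
  obtain x where x: "x \<in> N v" "x \<noteq> s1" "x \<noteq> s2" "\<And>y. y \<in> N v \<Longrightarrow> y \<noteq> s1 \<Longrightarrow> y \<noteq> s2 \<Longrightarrow> y \<noteq> x \<Longrightarrow> a x y"
    using source_exists[OF d v, of "N v - {s1, s2}"] ne[of "{s1, s2}"] by (auto simp: card_insert_if)
  have xV: "x \<in> V" using x by (auto simp: in_N)
  have "y = z" if "y \<in> N x \<inter> N v" "z \<in> N x \<inter> N v" for y z
  proof (rule ccontr)
    assume "y \<noteq> z"
    moreover have False if "y \<in> N x \<inter> N v" "z \<in> N x \<inter> N v" "a y z" for y z
      using arc_in_N_no_triangle[OF d v, of x y z] that x xV v irrefl by (auto simp: in_N)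
    ultimately show False using that semicomplete[of y z] by (auto simp: in_N)
  qed
  then have "card (N x \<inter> N v) \<le> 1" using finite_N by (simp add: card_le_Suc0_iff_eq)
  then have "card (insert v (N x \<inter> N v)) \<le> 2" using card_insert_le_m1[of 2] by simp
  then have "\<not> N x \<subseteq> insert v (N x \<inter> N v)"
    using deg[OF xV] card_mono[of "insert v (N x \<inter> N v)" "N x"] finite_N by force
  then obtain w where w: "w \<in> N x" "w \<noteq> v" "w \<notin> N v" by blast
  then have wV: "w \<in> V" "a w x" "a x w" by (auto simp: in_N)
  have "a s w" if "s \<in> N v" "a s x" for s
  proof -
    have "\<not> a w s" using arc_in_N_no_triangle[OF d v wV(1) that(1) x(1) that(2) wV(3)] w by blast
    then show ?thesis using semicomplete[of s w] that w wV by (auto simp: in_N)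
  qed
  then have "{s1, s2, x} \<subseteq> L v w" using s1 s2 x wV by (auto simp: in_L)
  moreover have "\<not> a y w" if "y \<in> N v" "a x y" for y
    using arc_in_N_no_triangle[OF d v wV(1) x(1) that] wV w by blast
  then have "L v w \<subseteq> {s1, s2, x}" using x(4) by (fastforce simp: in_L)
  ultimately have "L v w = {s1, s2, x}" by blast
  then have "w \<in> gap v 3" using s1 s2 x w wV by (auto simp: gap_def)
  then show ?thesis by blast
qed

text \<open>The bound six is three plus three: a vertex of the gap at position 3 sees at least three
  neighbours on either side, more than the two exceptions.\<close>

lemma ex_small_degree:
  assumes "V \<noteq> {}"
  shows "\<exists>v\<in>V. card (N v) < 6"
proof (rule ccontr)
  assume "\<not> ?thesis"
  then have deg: "card (N v) \<ge> 6" if "v \<in> V" for v using that by (meson not_less)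
  obtain v where v: "v \<in> V" and min: "\<And>u. u \<in> V \<Longrightarrow> card (gap v 3) \<le> card (gap u 3)"
    using ex_has_least_nat[of "\<lambda>v. v \<in> V" _ "\<lambda>v. card (gap v 3)"] assms by blast
  define I where "I = gap v 3"
  have "I \<noteq> {}" unfolding I_def using gap_nonempty[OF v deg[OF v]] deg by force
  obtain E where E: "finite E" "card E \<le> 2"
    and mod: "\<And>z. z \<in> V - I - E \<Longrightarrow> (\<forall>u\<in>I. \<not> a u z) \<or> (\<forall>u\<in>I. \<not> a z u)"
    using gap_near_module[OF v, of 3] deg[OF v] unfolding I_def[symmetric] by auto
  obtain u where u: "u \<in> I" "u \<in> V" using \<open>I \<noteq> {}\<close> by (auto simp: I_def gap_def)
  have finI: "finite I" by (simp add: I_def finite_gap)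
  have NI: "N u \<subseteq> I \<union> E" using mod u by (fastforce simp: in_N)
  \<comment> \<open>Three bidirectional neighbours of \<open>u\<close> cannot all be among the at
    most two exceptions.\<close>
  have ex: "\<exists>x\<in>I. x \<in> S" if "S \<subseteq> N u" "card S \<ge> 3" for S
  proof (rule ccontr)
    assume "\<not> ?thesis"
    with that NI have "S \<subseteq> E" by blast
    then have "card S \<le> card E" by (rule card_mono[OF E(1)])
    then show False using that E by linarith
  qed
  \<comment> \<open>A vertex \<open>z\<close> in the gap of \<open>u\<close> has an arc from some
    vertex of \<open>I\<close> and an arc to another one, so it violates the module property unless
    it lies in \<open>I\<close> or \<open>E\<close>.\<close>
  have JI: "gap u 3 \<subseteq> I \<union> E - N u"
  proof
    fix z assume z: "z \<in> gap u 3"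
    then have zV: "z \<in> V" "z \<notin> N u" "card (L u z) = 3" by (auto simp: gap_def)
    obtain x where x: "x \<in> I" "x \<in> L u z" using ex[OF L_subset, of z] zV by auto
    have "card (N u - L u z) \<ge> 3"
      using deg[OF u(2)] zV finite_L L_subset by (simp add: card_Diff_subset)
    then obtain y where y: "y \<in> I" "y \<in> N u - L u z" using ex[of "N u - L u z"] by auto
    then have "a z y" "a x z" using semicomplete[of y z] zV x by (auto simp: in_L in_N)
    then have "z \<in> I \<union> E" using mod[of z] x y zV by blast
    then show "z \<in> I \<union> E - N u" using zV by blast
  qed
  have "card I \<le> card (gap u 3)" using min[OF u(2)] by (simp add: I_def)
  also have "\<dots> \<le> card (I \<union> E - N u)" using JI finI E by (intro card_mono) auto
  also have "\<dots> = card (I \<union> E) - card (N u)" using NI finite_N by (rule card_Diff_subset[rotated])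
  also have "\<dots> \<le> card I + 2 - 6" using card_Un_le[of I E] E deg[OF u(2)] by linarith
  \<comment> \<open>If the natural subtraction truncates to zero, nonemptiness of \<open>I\<close>
    still gives strictness.\<close>
  also have "\<dots> < card I" using \<open>I \<noteq> {}\<close> finI by (simp add: card_gt_0_iff)
  finally show False by simp
qed

end

lemma U5_free_subset:
  assumes "U5_free V a" "W \<subseteq> V"
  shows "U5_free W a"
proof -
  interpret U5_free V a by fact
  show ?thesis
  proof
    show "finite W" using assms(2) finite_V finite_subset by blast
    fix p1 p2 p3 p4 p5
    assume "p1 \<in> W" "p2 \<in> W" "p3 \<in> W" "p4 \<in> W" "p5 \<in> W" "a p1 p2" "a p1 p3" "a p1 p5" "a p2 p3" "a p2 p4"
      "a p3 p4" "a p3 p5" "a p4 p5" "a p5 p2" "a p4 p1"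
    then show False using no_U5[of p1 p2 p3 p4 p5] assms(2) by blast
  qed (use irrefl semicomplete assms(2) in auto)
qed

text \<open>Repeatedly delete a vertex with at most five bidirectional neighbours. Antisymmetry of
  \<open>R\<close> makes each bidirectional pair count at most once.\<close>

lemma card_bidirectional_le:
  assumes "U5_free V a" "R \<subseteq> {(u, v). u \<in> V \<and> v \<in> V \<and> a u v \<and> a v u}" "\<And>u v. (u, v) \<in> R \<Longrightarrow> (v, u) \<notin> R"
  shows "card R \<le> 5 * card V"
  using assms
proof (induction "card V" arbitrary: V R rule: less_induct)
  case less
  interpret U5_free V a by fact
  show ?case
  proof (cases "V = {}")
    case True
    then have "R = {}" using less.prems(2) by auto
    then show ?thesis by simp
  next
    case False
    then obtain v where v: "v \<in> V" "card (N v) < 6" using ex_small_degree by blast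
    define Rv where "Rv = {(x, y) \<in> R. x = v \<or> y = v}"
    define R' where "R' = {(x, y) \<in> R. x \<noteq> v \<and> y \<noteq> v}"
    have cV: "card (V - {v}) < card V" "card V = Suc (card (V - {v}))"
      using v(1) card_Suc_Diff1[OF finite_V v(1)] by simp_all
    have "card R' \<le> 5 * card (V - {v})"
    proof (rule less.hyps[OF cV(1)])
      show "U5_free (V - {v}) a" using less.prems(1) by (rule U5_free_subset) blast
      show "R' \<subseteq> {(x, y). x \<in> V - {v} \<and> y \<in> V - {v} \<and> a x y \<and> a y x}"
        using less.prems(2) by (auto simp: R'_def)
      show "\<And>x y. (x, y) \<in> R' \<Longrightarrow> (y, x) \<notin> R'" using less.prems(3) by (auto simp: R'_def)
    qed
    moreover have "card Rv \<le> card (N v)"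
    proof (rule card_inj_on_le)
      show "inj_on (\<lambda>(x, y). if x = v then y else x) Rv"
        using less.prems(2,3) irrefl by (force simp: inj_on_def Rv_def)
      show "(\<lambda>(x, y). if x = v then y else x) ` Rv \<subseteq> N v"
        using less.prems(2) by (auto simp: Rv_def in_N)
    qed (rule finite_N)
    moreover have "R = R' \<union> Rv" by (auto simp: R'_def Rv_def)
    then have "card R \<le> card R' + card Rv" by (simp add: card_Un_le)
    ultimately show ?thesis using v(2) cV(2) by linarith
  qed
qed

section \<open>The extremal function of \<open>U5\<close>\<close>

text \<open>An isomorphism consists of separate vertex and arc maps; between pair digraphs the ends
  of an arc are its components, so the vertex map determines the arc map.\<close>

lemma digraph_iso_pairD:
  assumes "digraph_iso (with_proj G) (with_proj H)"
  shows "\<exists>h. inj_on h (pverts G) \<and> pverts H = h ` pverts G \<and> parcs H = map_prod h h ` parcs G"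
proof -
  obtain f where f: "pre_digraph.digraph_isomorphism (with_proj G) f" "with_proj H = app_iso f (with_proj G)"
    using assms by (auto simp: digraph_iso_def)
  have "iso_tail f = fst" "iso_head f = snd" and *: "pverts H = iso_verts f ` pverts G" "parcs H = iso_arcs f ` parcs G"
    using f(2) by (auto simp: app_iso_def with_proj_def)
  then have "iso_arcs f e = map_prod (iso_verts f) (iso_verts f) e" if "e \<in> parcs G" for e
    using f(1) that by (auto simp: pre_digraph.digraph_isomorphism_def with_proj_def prod_eq_iff)
  with * f(1) show ?thesis
    by (intro exI[of _ "iso_verts f"]) (auto simp: pre_digraph.digraph_isomorphism_def)
qed

lemma digraph_iso_pairI:
  assumes "pair_wf_digraph G" "inj_on h (pverts G)" "pverts H = h ` pverts G" "parcs H = map_prod h h ` parcs G"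
  shows "digraph_iso (with_proj G) (with_proj H)"
proof -
  interpret pair_wf_digraph G by fact
  have "parcs G \<subseteq> pverts G \<times> pverts G"
    using arc_fst_in_verts arc_snd_in_verts by force
  then have "inj_on (map_prod h h) (parcs G)"
    using inj_on_subset[OF map_prod_inj_on[OF assms(2) assms(2)]] by blast
  then have "pre_digraph.digraph_isomorphism (with_proj G) \<lparr>iso_verts = h, iso_arcs = map_prod h h, iso_head = snd, iso_tail = fst\<rparr>"
    using assms(2) wf_digraph_axioms by (auto simp: pre_digraph.digraph_isomorphism_def)
  moreover have "with_proj H = app_iso \<lparr>iso_verts = h, iso_arcs = map_prod h h, iso_head = snd, iso_tail = fst\<rparr> (with_proj G)"
    using assms(3,4) by (auto simp: app_iso_def with_proj_def)
  ultimately show ?thesis by (auto simp: digraph_iso_def)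
qed

lemma pverts_U5: "pverts U5 = {1, 2, 3, 4, 5}"
  unfolding U5_def pair_pre_digraph.simps by (rule set_eqI) (simp only: atLeastAtMost_iff insert_iff empty_iff, presburger)

lemma parcs_U5:
  "parcs U5 = {(1, 2), (1, 3), (1, 5), (2, 3), (2, 4), (3, 4), (3, 5), (4, 5), (5, 2), (4, 1)}"
  unfolding U5_def pair_pre_digraph.simps
  by (rule set_eqI) (simp only: split_paired_all mem_Collect_eq case_prod_conv Un_iff Diff_iff
    prod.inject atLeastAtMost_iff insert_iff empty_iff, presburger)

lemma contains_copy_U5_iff:
  assumes "pair_digraph D"
  shows "contains_copy D U5 \<longleftrightarrow> (\<exists>p1 p2 p3 p4 p5. {p1, p2, p3, p4, p5} \<subseteq> pverts D \<and>
    {(p1, p2), (p1, p3), (p1, p5), (p2, p3), (p2, p4), (p3, p4), (p3, p5), (p4, p5), (p5, p2), (p4, p1)} \<subseteq> parcs D)"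
    (is "?L \<longleftrightarrow> ?R")
proof
  interpret pair_digraph D by fact
  assume ?L
  then obtain S where S: "subgraph (with_proj S) (with_proj D)" "digraph_iso (with_proj S) (with_proj U5)"
    by (auto simp: contains_copy_def)
  have "digraph_iso (with_proj U5) (with_proj S)"
    using digraph_iso_swap[OF _ S(2)] S(1) unfolding subgraph_def by blast
  then obtain h where h: "pverts S = h ` pverts U5" "parcs S = map_prod h h ` parcs U5"
    using digraph_iso_pairD by blast
  have "pverts S \<subseteq> pverts D" "parcs S \<subseteq> parcs D" using S(1) by (auto simp: subgraph_def)
  then have "{h 1, h 2, h 3, h 4, h 5} \<subseteq> pverts D" and "{(h 1, h 2), (h 1, h 3), (h 1, h 5), (h 2, h 3),
      (h 2, h 4), (h 3, h 4), (h 3, h 5), (h 4, h 5), (h 5, h 2), (h 4, h 1)} \<subseteq> parcs D"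
    unfolding h parcs_U5 pverts_U5 by (simp_all only: image_insert image_empty map_prod_simp)
  then show ?R by (intro exI conjI)
next
  interpret pair_digraph D by fact
  assume ?R
  then obtain p1 p2 p3 p4 p5 where p: "{p1, p2, p3, p4, p5} \<subseteq> pverts D"
    "{(p1, p2), (p1, p3), (p1, p5), (p2, p3), (p2, p4), (p3, p4), (p3, p5), (p4, p5), (p5, p2), (p4, p1)} \<subseteq> parcs D"
    by (elim exE conjE)
  define h where "h = (\<lambda>_. p5)(1 := p1, 2 := p2, 3 := p3, 4 := p4 :: 'a, 5 :: nat := p5)"
  define S where "S = \<lparr>pverts = h ` pverts U5, parcs = map_prod h h ` parcs U5\<rparr>"
  have "u \<noteq> v" if "(u, v) \<in> parcs D" for u v using pair_no_loops[OF that] by simp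
  \<comment> \<open>Any two vertices of \<open>U5\<close> are adjacent, so looplessness of
    \<open>D\<close> already makes the five vertices distinct.\<close>
  then have "distinct [p1, p2, p3, p4, p5]" using p(2) by auto
  then have inj: "inj_on h (pverts U5)" by (auto simp: inj_on_def h_def pverts_U5)
  have sub: "pverts S \<subseteq> pverts D" "parcs S \<subseteq> parcs D"
    using p by (auto simp: S_def pverts_U5 parcs_U5 h_def)
  have wfU: "pair_wf_digraph U5" by unfold_locales (auto simp: pverts_U5 parcs_U5)
  have wfS: "pair_wf_digraph S"
    by unfold_locales (auto simp: S_def pverts_U5 parcs_U5)
  have "digraph_iso (with_proj U5) (with_proj S)"
    using wfU inj by (rule digraph_iso_pairI) (auto simp: S_def)
  then have "digraph_iso (with_proj S) (with_proj U5)"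
    using digraph_iso_swap[OF iffD2[OF wf_digraph_wp_iff wfU]] by blast
  moreover have "subgraph (with_proj S) (with_proj D)"
    using sub wfS wf_digraph_axioms unfolding subgraph_def compatible_def
    by (simp add: wf_digraph_wp_iff)
  ultimately show ?L unfolding contains_copy_def by blast
qed

section \<open>Linear bounds for the extremal function\<close>

definition t_bound :: "nat \<Rightarrow> nat \<Rightarrow> bool" where
  "t_bound n t \<longleftrightarrow> (\<forall>T :: nat pair_pre_digraph. tournament T \<and> card (pverts T) = n \<longrightarrow>
     (\<forall>R. R \<subseteq> (parcs T)\<inverse> \<and> card R = t \<longrightarrow> contains_copy (T\<lparr>parcs := parcs T \<union> R\<rparr>) U5))"

lemma t_min_U5: "t_min n U5 = (LEAST t. t_bound n t)"
  by (simp add: t_min_def t_bound_def)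

lemma pair_digraph_add_reversals:
  assumes "pair_digraph T" "R \<subseteq> (parcs T)\<inverse>"
  shows "pair_digraph (T\<lparr>parcs := parcs T \<union> R\<rparr>)"
proof -
  interpret pair_digraph T by fact
  have "finite R" using assms(2) pair_finite_arcs finite_subset by blast
  moreover have "(v, u) \<in> parcs T" if "(u, v) \<in> R" for u v using assms(2) that by blast
  ultimately have "fst e \<in> pverts T \<and> snd e \<in> pverts T \<and> fst e \<noteq> snd e" if "e \<in> parcs T \<union> R" for e
    using that in_arcsD1 in_arcsD2 pair_no_loops by (cases e) fastforce
  then show ?thesis
    using \<open>finite R\<close> pair_finite_verts pair_finite_arcs by unfold_locales simp_all
qed

lemma t_bound_linear: "t_bound n (5 * n + 1)"
  unfolding t_bound_def
proof (intro allI impI, elim conjE)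
  fix T :: "nat pair_pre_digraph" and R
  assume T: "tournament T" "card (pverts T) = n" and R: "R \<subseteq> (parcs T)\<inverse>" "card R = 5 * n + 1"
  define D where "D = T\<lparr>parcs := parcs T \<union> R\<rparr>"
  have wT: "pair_digraph T" using T by (simp add: tournament_def)
  interpret T: pair_digraph T by fact
  have wD: "pair_digraph D" unfolding D_def using wT R(1) by (rule pair_digraph_add_reversals)
  interpret pair_digraph D by fact
  have "\<not> U5_free (pverts D) (\<lambda>u v. (u, v) \<in> parcs D)"
  proof
    assume "U5_free (pverts D) (\<lambda>u v. (u, v) \<in> parcs D)"
    moreover have R': "(v, u) \<in> parcs T" if "(u, v) \<in> R" for u v using that R(1) by blast
    then have "R \<subseteq> {(u, v). u \<in> pverts D \<and> v \<in> pverts D \<and> (u, v) \<in> parcs D \<and> (v, u) \<in> parcs D}"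
      by (auto simp: D_def dest: T.in_arcsD1 T.in_arcsD2)
    \<comment> \<open>A tournament has only one arc on each pair, so its reversals are antisymmetric
      and each new arc makes a different pair bidirectional.\<close>
    moreover have "(v, u) \<notin> R" if "(u, v) \<in> R" for u v
    proof
      assume "(v, u) \<in> R"
      then have "(u, v) \<in> parcs T" "(v, u) \<in> parcs T" using R' that by auto
      moreover from this have "u \<in> pverts T" "v \<in> pverts T" "u \<noteq> v"
        using T.in_arcsD1 T.in_arcsD2 T.pair_no_loops[of "(u, v)"] by auto
      ultimately show False using T(1) unfolding tournament_def by blast
    qed
    ultimately have "card R \<le> 5 * card (pverts D)" by (rule card_bidirectional_le)
    then show False using R(2) T(2) by (simp add: D_def)
  qed
  moreover have "U5_free (pverts D) (\<lambda>u v. (u, v) \<in> parcs D)" if no: "\<not> contains_copy D U5"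
  proof
    show "finite (pverts D)" by (rule pair_finite_verts)
    show "(u, u) \<notin> parcs D" for u using pair_no_loops[of "(u, u)"] by auto
    show "(u, v) \<in> parcs D \<or> (v, u) \<in> parcs D" if "u \<in> pverts D" "v \<in> pverts D" "u \<noteq> v" for u v
    proof -
      have "u \<in> pverts T" "v \<in> pverts T" using that by (simp_all add: D_def)
      then have "(u, v) \<in> parcs T \<or> (v, u) \<in> parcs T" using T(1) that(3) unfolding tournament_def by meson
      then show ?thesis unfolding D_def by auto
    qed
    fix p1 p2 p3 p4 p5
    assume "p1 \<in> pverts D" "p2 \<in> pverts D" "p3 \<in> pverts D" "p4 \<in> pverts D" "p5 \<in> pverts D"
      "(p1, p2) \<in> parcs D" "(p1, p3) \<in> parcs D" "(p1, p5) \<in> parcs D" "(p2, p3) \<in> parcs D" "(p2, p4) \<in> parcs D"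
      "(p3, p4) \<in> parcs D" "(p3, p5) \<in> parcs D" "(p4, p5) \<in> parcs D" "(p5, p2) \<in> parcs D" "(p4, p1) \<in> parcs D"
    then have "{p1, p2, p3, p4, p5} \<subseteq> pverts D \<and> {(p1, p2), (p1, p3), (p1, p5), (p2, p3), (p2, p4), (p3, p4),
        (p3, p5), (p4, p5), (p5, p2), (p4, p1)} \<subseteq> parcs D"
      by (simp only: insert_subset empty_subsetI simp_thms)
    then have "contains_copy D U5" unfolding contains_copy_U5_iff[OF wD] by (intro exI)
    with no show False by blast
  qed
  ultimately show "contains_copy D U5" by blast
qed

lemma t_bound_imp_ge:
  assumes "t_bound n t"
  shows "n \<le> t"
proof (rule ccontr)
  assume "\<not> n \<le> t"
  then have tn: "t < n" by simp
  define T :: "nat pair_pre_digraph" where "T = \<lparr>pverts = {..<n}, parcs = {(i, j). i < j \<and> j < n}\<rparr>"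
  \<comment> \<open>Reversals of \<open>t\<close> of the \<open>n - 1\<close> arcs leaving the
    source 0; this needs \<open>t < n\<close>.\<close>
  define R where "R = (\<lambda>i. (i, 0 :: nat)) ` {1..t}"
  have "parcs T \<subseteq> {..<n} \<times> {..<n}" by (auto simp: T_def)
  then have fin: "finite (parcs T)" by (rule finite_subset) simp
  have wT: "pair_digraph T"
    using fin by unfold_locales (auto simp: T_def)
  then have T: "tournament T" by (auto simp: tournament_def T_def)
  have R: "R \<subseteq> (parcs T)\<inverse>" using tn by (auto simp: R_def T_def)
  have "card R = t" by (simp add: R_def card_image inj_on_def)
  then have "contains_copy (T\<lparr>parcs := parcs T \<union> R\<rparr>) U5"
    using assms T R by (auto simp: t_bound_def T_def)
  then obtain p1 p2 p3 p4 p5 where "{(p1, p2), (p1, p3), (p1, p5), (p2, p3), (p2, p4), (p3, p4), (p3, p5),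
      (p4, p5), (p5, p2), (p4, p1)} \<subseteq> parcs (T\<lparr>parcs := parcs T \<union> R\<rparr>)"
    unfolding contains_copy_U5_iff[OF pair_digraph_add_reversals[OF wT R]] by (elim exE conjE)
  moreover have "i < j \<or> 0 < i \<and> j = 0" if "(i, j) \<in> parcs (T\<lparr>parcs := parcs T \<union> R\<rparr>)" for i j
    using that by (auto simp: T_def R_def)
  ultimately have "p1 < p2 \<or> 0 < p1 \<and> p2 = 0" "p1 < p3 \<or> 0 < p1 \<and> p3 = 0" "p2 < p3 \<or> 0 < p2 \<and> p3 = 0"
    "p2 < p4 \<or> 0 < p2 \<and> p4 = 0" "p3 < p4 \<or> 0 < p3 \<and> p4 = 0" "p3 < p5 \<or> 0 < p3 \<and> p5 = 0"
    "p4 < p1 \<or> 0 < p4 \<and> p1 = 0" "p5 < p2 \<or> 0 < p5 \<and> p2 = 0"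
    "p1 < p5 \<or> 0 < p1 \<and> p5 = 0" "p4 < p5 \<or> 0 < p4 \<and> p5 = 0"
    by (simp_all only: insert_subset)
  \<comment> \<open>Every directed triangle has to pass through 0, but the triangles 124, 134, 235,
    245 of \<open>U5\<close> have no common vertex.\<close>
  then show False by (smt (verit) less_trans less_irrefl_nat neq0_conv)
qed

lemma t_min_U5_bounds: "n \<le> t_min n U5" "t_min n U5 \<le> 5 * n + 1"
proof -
  have "t_bound n (t_min n U5)"
    unfolding t_min_U5 by (rule LeastI[of "t_bound n", OF t_bound_linear])
  then show "n \<le> t_min n U5" by (rule t_bound_imp_ge)
  show "t_min n U5 \<le> 5 * n + 1"
    unfolding t_min_U5 by (rule Least_le[of "t_bound n", OF t_bound_linear])
qed

lemma t_min_U5_polylog: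
  "\<exists>g \<in> O(\<lambda>_::nat. 1::real). \<forall>\<^sub>F n in sequentially. real (t_min n U5) = real n * log 2 (real n) powr g n"
proof
  \<comment> \<open>The required equation forces this exponent. Since the quotient
    \<open>t_min n U5 / n\<close> lies between 1 and 6, the exponent is bounded once the base is at
    least \<open>exp 1\<close>, and \<open>n \<ge> 8\<close> makes the base at least 3.\<close>
  define g where "g n = log (log 2 (real n)) (real (t_min n U5) / real n)" for n
  have n: "real (t_min n U5) = real n * log 2 (real n) powr g n \<and> norm (g n) \<le> ln 6" if "n \<ge> 8" for n
  proof -
    have "log 2 (real n) \<ge> log 2 (2 ^ 3)" using that by (subst log_le_cancel_iff) auto
    then have l: "log 2 (real n) \<ge> 3" by (subst (asm) log_nat_power) auto
    have q: "1 \<le> real (t_min n U5) / real n" "real (t_min n U5) / real n \<le> 6"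
      using that t_min_U5_bounds[of n] by (auto simp: field_simps)
    have e: "ln (log 2 (real n)) \<ge> 1"
      using l exp_le by (subst ln_ge_iff) auto
    have "g n = ln (real (t_min n U5) / real n) / ln (log 2 (real n))" by (simp add: g_def log_def)
    moreover have "0 \<le> ln (real (t_min n U5) / real n)" "ln (real (t_min n U5) / real n) \<le> ln 6"
      using q by auto
    moreover have "ln 6 * 1 \<le> ln 6 * ln (log 2 (real n))" by (intro mult_left_mono e) simp
    then have "ln (real (t_min n U5) / real n) \<le> ln 6 * ln (log 2 (real n))"
      using \<open>ln (real (t_min n U5) / real n) \<le> ln 6\<close> by linarith
    ultimately have gb: "0 \<le> g n" "g n \<le> ln 6"
      using e by (simp_all add: divide_le_eq)
    have "log 2 (real n) powr g n = real (t_min n U5) / real n"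
      unfolding g_def using l q by (intro powr_log_cancel) auto
    with gb that show ?thesis by simp
  qed
  show "g \<in> O(\<lambda>_. 1)"
    by (rule bigoI[of _ "ln 6"]) (use n in \<open>auto intro!: eventually_sequentiallyI[of 8]\<close>)
  show "\<forall>\<^sub>F n in sequentially. real (t_min n U5) = real n * log 2 (real n) powr g n"
    using n by (intro eventually_sequentiallyI[of 8]) blast
qed

section \<open>Sparsity of \<open>Q5\<close>\<close>

lemma transitive_digraph_trans:
  assumes G: "tournament G" and W: "W \<subseteq> pverts G" and t: "transitive_digraph (with_proj G \<restriction> W)"
    and xyz: "x \<in> W" "y \<in> W" "z \<in> W" "(x, y) \<in> parcs G" "(y, z) \<in> parcs G"
  shows "(x, z) \<in> parcs G"
proof (rule ccontr)
  assume xz: "(x, z) \<notin> parcs G"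
  have pd: "pair_digraph G" and tour: "\<And>u v. \<lbrakk>u \<in> pverts G; v \<in> pverts G; u \<noteq> v\<rbrakk> \<Longrightarrow> (u, v) \<in> parcs G \<longleftrightarrow> (v, u) \<notin> parcs G"
    using G unfolding tournament_def by blast+
  interpret pair_digraph G by (rule pd)
  have V: "x \<in> pverts G" "y \<in> pverts G" "z \<in> pverts G" using W xyz by blast+
  have ne: "x \<noteq> y" "y \<noteq> z"
    using pair_no_loops[OF xyz(4)] pair_no_loops[OF xyz(5)] by simp_all
  have "x \<noteq> z" using tour[OF V(1,2) ne(1)] xyz(4,5) by blast
  then have zx: "(z, x) \<in> parcs G" using tour[OF V(1,3)] xz by blast
  have "pre_digraph.cycle (with_proj G \<restriction> W) [(x, y), (y, z), (z, x)]"
    unfolding pre_digraph.cycle_def pre_digraph.awalk_def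
    using xyz zx ne \<open>x \<noteq> z\<close>
    by (intro exI[of _ x])
      (simp add: pre_digraph.cas.simps pre_digraph.awalk_verts.simps induce_subgraph_def with_proj_simps)
  then show False using t unfolding transitive_digraph_def by blast
qed

definition in_rank :: "'a pair_pre_digraph \<Rightarrow> 'a set \<Rightarrow> 'a \<Rightarrow> nat" where
  "in_rank G W v = card {u \<in> W. (u, v) \<in> parcs G}"

text \<open>Along an arc from \<open>x\<close> to \<open>y\<close>, transitivity includes the
  in-neighbours of \<open>x\<close> in those of \<open>y\<close>, and \<open>x\<close> itself is
  new. So the ranks determine a transitive tournament.\<close>

lemma in_rank_less_iff:
  assumes G: "tournament G" and W: "W \<subseteq> pverts G" and t: "transitive_digraph (with_proj G \<restriction> W)"
    and uv: "u \<in> W" "v \<in> W"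
  shows "(u, v) \<in> parcs G \<longleftrightarrow> in_rank G W u < in_rank G W v"
proof -
  have pd: "pair_digraph G" and tour: "\<And>u v. \<lbrakk>u \<in> pverts G; v \<in> pverts G; u \<noteq> v\<rbrakk> \<Longrightarrow> (u, v) \<in> parcs G \<longleftrightarrow> (v, u) \<notin> parcs G"
    using G unfolding tournament_def by blast+
  interpret pair_digraph G by (rule pd)
  have fin: "finite W" using W pair_finite_verts finite_subset by blast
  have loop: "(x, x) \<notin> parcs G" for x using pair_no_loops[of "(x, x)"] by auto
  have less: "in_rank G W x < in_rank G W y" if xy: "x \<in> W" "y \<in> W" "(x, y) \<in> parcs G" for x y
    unfolding in_rank_def
  proof (rule psubset_card_mono)
    have "{u \<in> W. (u, x) \<in> parcs G} \<subseteq> {u \<in> W. (u, y) \<in> parcs G}"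
      using transitive_digraph_trans[OF G W t _ xy(1,2) _ xy(3)] by blast
    moreover have "x \<in> {u \<in> W. (u, y) \<in> parcs G} - {u \<in> W. (u, x) \<in> parcs G}" using xy loop by blast
    ultimately show "{u \<in> W. (u, x) \<in> parcs G} \<subset> {u \<in> W. (u, y) \<in> parcs G}" by blast
  qed (use fin in simp)
  show ?thesis
  proof
    assume "in_rank G W u < in_rank G W v"
    then have "u \<noteq> v" "\<not> in_rank G W v < in_rank G W u" by auto
    then show "(u, v) \<in> parcs G" using less[OF uv(2,1)] tour[of u v] uv W by blast
  qed (use less uv in blast)
qed

text \<open>The vertex \<open>v\<close> may lie outside \<open>W\<close>: the encoding stores all
  three ranks for every vertex.\<close>

lemma in_rank_less:
  assumes "pair_digraph G" "W \<subseteq> pverts G" "v \<in> pverts G"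
  shows "in_rank G W v < card (pverts G)"
proof -
  interpret pair_digraph G by fact
  have "{u \<in> W. (u, v) \<in> parcs G} \<subseteq> pverts G - {v}" using assms(2) pair_no_loops by fastforce
  then have "in_rank G W v \<le> card (pverts G - {v})"
    unfolding in_rank_def using pair_finite_verts by (intro card_mono) auto
  also have "\<dots> < card (pverts G)" using pair_finite_verts assms(3) by (rule card_Diff1_less)
  finally show ?thesis .
qed

definition decode_circular :: "'a set \<Rightarrow> ('a \<Rightarrow> nat) \<Rightarrow> 'a pair_pre_digraph" where
  "decode_circular V h = \<lparr>pverts = V,
     parcs = {(u, v). u \<in> V \<and> v \<in> V \<and> (h u, h v) \<in> parcs (circular_tournament (card V))}\<rparr>"

text \<open>Tournaments of the second kind in \<open>Q5\<close> are encoded by the part of each vertex together with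
  its ranks in the three transitive tournaments obtained by deleting one part.\<close>

definition decode_parts :: "'a set \<Rightarrow> ('a \<Rightarrow> nat \<times> nat \<times> nat \<times> nat) \<Rightarrow> 'a pair_pre_digraph" where
  "decode_parts V h = \<lparr>pverts = V,
     parcs = {(u, v). u \<in> V \<and> v \<in> V \<and>
       (case (h u, h v) of ((p, a1, a2, a3), (q, b1, b2, b3)) \<Rightarrow>
          if p \<noteq> 1 \<and> q \<noteq> 1 then a1 < b1 else if p \<noteq> 2 \<and> q \<noteq> 2 then a2 < b2 else a3 < b3)}\<rparr>"

lemma pair_pre_digraph_eqI:
  assumes "pverts G = pverts H" "parcs G = parcs H"
  shows "G = (H :: 'a pair_pre_digraph)"
  using assms by (cases G, cases H) simp

lemma pverts_circular: "pverts (circular_tournament n) = {1..n}"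
  by (simp add: circular_tournament_def)

text \<open>Counting from above only requires every member to have a code; a tournament may have
  several.\<close>

lemma Q5_subset_decode:
  assumes V: "finite V" "card V = n"
  shows "{G \<in> Q5. pverts G = V} \<subseteq> decode_circular V ` (V \<rightarrow>\<^sub>E {1..n}) \<union>
    decode_parts V ` (V \<rightarrow>\<^sub>E {1..3} \<times> {..<n} \<times> {..<n} \<times> {..<n})"
proof
  fix G assume "G \<in> {G \<in> Q5. pverts G = V}"
  then have G: "tournament G" "pverts G = V" and
    cases: "(\<exists>n. odd n \<and> digraph_iso (with_proj G) (with_proj (circular_tournament n))) \<or>
      (\<exists>P :: nat \<Rightarrow> 'a set. pverts G = P 1 \<union> P 2 \<union> P 3 \<and> disjoint_family_on P {1..3} \<and>
         (\<forall>i j. 1 \<le> i \<and> i < j \<and> j \<le> 3 \<longrightarrow> transitive_digraph (with_proj G \<restriction> (P i \<union> P j))))"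
    unfolding Q5_def by blast+
  have pd: "pair_digraph G" using G(1) unfolding tournament_def by blast
  interpret pair_digraph G by (rule pd)
  have parcs: "parcs G = {(u, v). u \<in> V \<and> v \<in> V \<and> (u, v) \<in> parcs G}"
    using in_arcsD1 in_arcsD2 unfolding G(2) by blast
  from cases show "G \<in> decode_circular V ` (V \<rightarrow>\<^sub>E {1..n}) \<union>
    decode_parts V ` (V \<rightarrow>\<^sub>E {1..3} \<times> {..<n} \<times> {..<n} \<times> {..<n})"
  proof (elim disjE exE conjE)
    fix k assume "digraph_iso (with_proj G) (with_proj (circular_tournament k))"
    then obtain h where h: "inj_on h V" "{1..k} = h ` V" "parcs (circular_tournament k) = map_prod h h ` parcs G"
      using digraph_iso_pairD[of G "circular_tournament k"] G(2) pverts_circular[of k] by metis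
    \<comment> \<open>The order of the circular tournament is not given in advance; the bijection
      fixes it.\<close>
    have "k = n" using card_image[OF h(1)] V(2) h(2)[symmetric] by simp
    have "(u, v) \<in> parcs G \<longleftrightarrow> (h u, h v) \<in> parcs (circular_tournament n)" if "u \<in> V" "v \<in> V" for u v
    proof
      assume "(h u, h v) \<in> parcs (circular_tournament n)"
      then obtain x y where xy: "(x, y) \<in> parcs G" "h x = h u" "h y = h v" using h(3) \<open>k = n\<close> by auto
      moreover have "x \<in> V" "y \<in> V" using xy(1) in_arcsD1 in_arcsD2 G(2) by auto
      ultimately show "(u, v) \<in> parcs G" using inj_onD[OF h(1)] that by metis
    qed (use h(3) \<open>k = n\<close> in force)
    then have "parcs G = parcs (decode_circular V (restrict h V))"
      by (subst parcs) (simp add: decode_circular_def V(2) cong: conj_cong)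
    then have "G = decode_circular V (restrict h V)"
      by (intro pair_pre_digraph_eqI) (simp_all add: decode_circular_def G(2))
    moreover have "restrict h V \<in> V \<rightarrow>\<^sub>E {1..n}" using h(2) \<open>k = n\<close> by auto
    ultimately show ?thesis by blast
  next
    fix P :: "nat \<Rightarrow> 'a set"
    assume P: "pverts G = P 1 \<union> P 2 \<union> P 3" "disjoint_family_on P {1..3}"
      and tr: "\<forall>i j. 1 \<le> i \<and> i < j \<and> j \<le> 3 \<longrightarrow> transitive_digraph (with_proj G \<restriction> (P i \<union> P j))"
    define p where "p v = (if v \<in> P 1 then 1 else if v \<in> P 2 then 2 else 3 :: nat)" for v
    define h where "h = (\<lambda>v\<in>V. (p v, in_rank G (P 2 \<union> P 3) v, in_rank G (P 1 \<union> P 3) v, in_rank G (P 1 \<union> P 2) v))"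
    have sub: "P 2 \<union> P 3 \<subseteq> pverts G" "P 1 \<union> P 3 \<subseteq> pverts G" "P 1 \<union> P 2 \<subseteq> pverts G" using P(1) by blast+
    have tr': "transitive_digraph (with_proj G \<restriction> (P 2 \<union> P 3))" "transitive_digraph (with_proj G \<restriction> (P 1 \<union> P 3))"
      "transitive_digraph (with_proj G \<restriction> (P 1 \<union> P 2))"
      using tr by auto
    have disj: "P 1 \<inter> P 2 = {}" "P 1 \<inter> P 3 = {}" "P 2 \<inter> P 3 = {}"
      using P(2) by (auto simp: disjoint_family_on_def)
    have p: "p v \<noteq> 1 \<longleftrightarrow> v \<in> P 2 \<union> P 3" "p v \<noteq> 2 \<longleftrightarrow> v \<in> P 1 \<union> P 3" "p v \<noteq> 3 \<longleftrightarrow> v \<in> P 1 \<union> P 2" if "v \<in> V" for v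
      using that disj P(1) G(2) unfolding p_def by auto
    have "(u, v) \<in> parcs G \<longleftrightarrow> (if p u \<noteq> 1 \<and> p v \<noteq> 1 then in_rank G (P 2 \<union> P 3) u < in_rank G (P 2 \<union> P 3) v
        else if p u \<noteq> 2 \<and> p v \<noteq> 2 then in_rank G (P 1 \<union> P 3) u < in_rank G (P 1 \<union> P 3) v
        else in_rank G (P 1 \<union> P 2) u < in_rank G (P 1 \<union> P 2) v)" if uv: "u \<in> V" "v \<in> V" for u v
    proof -
      consider "p u \<noteq> 1 \<and> p v \<noteq> 1" | "\<not> (p u \<noteq> 1 \<and> p v \<noteq> 1)" "p u \<noteq> 2 \<and> p v \<noteq> 2"
        | "\<not> (p u \<noteq> 1 \<and> p v \<noteq> 1)" "\<not> (p u \<noteq> 2 \<and> p v \<noteq> 2)"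
        by blast
      then show ?thesis
      proof cases
        case 1
        then have "u \<in> P 2 \<union> P 3" "v \<in> P 2 \<union> P 3" using p(1) uv by blast+
        with 1 show ?thesis using in_rank_less_iff[OF G(1) sub(1) tr'(1)] by presburger
      next
        case 2
        then have "u \<in> P 1 \<union> P 3" "v \<in> P 1 \<union> P 3" using p(2) uv by blast+
        with 2 show ?thesis using in_rank_less_iff[OF G(1) sub(2) tr'(2)] by presburger
      next
        case 3
        \<comment> \<open>One of the two vertices is in part 1 and the other in part 2, so both
          avoid part 3.\<close>
        then have "p u \<noteq> 3" "p v \<noteq> 3" by auto
        then have "u \<in> P 1 \<union> P 2" "v \<in> P 1 \<union> P 2" using p(3) uv by blast+
        with 3 show ?thesis using in_rank_less_iff[OF G(1) sub(3) tr'(3)] by presburger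
      qed
    qed
    then have "parcs G = parcs (decode_parts V h)"
      by (subst parcs) (simp add: decode_parts_def h_def cong: conj_cong)
    then have "G = decode_parts V h"
      by (intro pair_pre_digraph_eqI) (simp_all add: decode_parts_def G(2))
    moreover have "h \<in> V \<rightarrow>\<^sub>E {1..3} \<times> {..<n} \<times> {..<n} \<times> {..<n}"
      using in_rank_less[OF pd sub(1)] in_rank_less[OF pd sub(2)] in_rank_less[OF pd sub(3)] V(2) G(2)
      by (auto simp: h_def p_def)
    ultimately show ?thesis by blast
  qed
qed

lemma card_Q5_le:
  assumes V: "finite V" "card V = n"
  shows "finite {G \<in> Q5. pverts G = V}" "card {G \<in> Q5. pverts G = V} \<le> n ^ n + (3 * n ^ 3) ^ n"
proof -
  let ?A = "V \<rightarrow>\<^sub>E {1..n}" and ?B = "V \<rightarrow>\<^sub>E {1..3 :: nat} \<times> {..<n} \<times> {..<n} \<times> {..<n}"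
  have fin: "finite ?A" "finite ?B" using V by (auto intro!: finite_PiE)
  have "card ?A = n ^ n" using V by (subst card_funcsetE) auto
  moreover have "card ?B = (3 * n ^ 3) ^ n"
    using V by (subst card_funcsetE) (auto simp: card_cartesian_product power3_eq_cube mult.assoc)
  moreover have "card (decode_circular V ` ?A \<union> decode_parts V ` ?B) \<le> card ?A + card ?B"
    by (rule order_trans[OF card_Un_le add_mono[OF card_image_le[OF fin(1)] card_image_le[OF fin(2)]]])
  moreover have "card {G \<in> Q5. pverts G = V} \<le> card (decode_circular V ` ?A \<union> decode_parts V ` ?B)"
    using Q5_subset_decode[OF V] fin by (intro card_mono) auto
  ultimately show "card {G \<in> Q5. pverts G = V} \<le> n ^ n + (3 * n ^ 3) ^ n" by linarith
  show "finite {G \<in> Q5. pverts G = V}"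
    using Q5_subset_decode[OF V] fin by (auto intro: finite_subset)
qed

section \<open>Random orientations and the counting bound\<close>

lemma finite_bidirectional_pairs:
  assumes "pair_digraph F"
  shows "finite (bidirectional_pairs F)"
proof -
  interpret pair_digraph F by fact
  have "bidirectional_pairs F \<subseteq> (\<lambda>(u, v). {u, v}) ` parcs F" unfolding bidirectional_pairs_def by auto
  then show ?thesis using pair_finite_arcs finite_subset by blast
qed

text \<open>The choice function is uniform on a set of
  \<open>2 ^ card (bidirectional_pairs F)\<close> elements, and different choices produce different
  tournaments.\<close>

lemma prob_random_tournament_le:
  assumes F: "pair_digraph F" and fin: "finite {G \<in> Q. pverts G = pverts F}"
  shows "measure_pmf.prob (random_tournament F) Q
    \<le> real (card {G \<in> Q. pverts G = pverts F}) / 2 ^ card (bidirectional_pairs F)"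
proof -
  define B where "B = bidirectional_pairs F"
  define S where "S = PiE_dflt B undefined (\<lambda>e. {(u, v). {u, v} = e})"
  define f where "f c = \<lparr> pverts = pverts F,
      parcs = {(u, v). (u, v) \<in> parcs F \<and> {u, v} \<notin> bidirectional_pairs F} \<union> c ` bidirectional_pairs F \<rparr>" for c
  have finB: "finite B" unfolding B_def using F by (rule finite_bidirectional_pairs)
  have e: "finite {(u, v). {u, v} = e} \<and> card {(u, v). {u, v} = e} = 2" if "e \<in> B" for e
  proof -
    obtain u v where uv: "e = {u, v}" "u \<noteq> v" using \<open>e \<in> B\<close> unfolding B_def bidirectional_pairs_def by blast
    have "{(u, v). {u, v} = e} = {(u, v), (v, u)}" unfolding uv(1) by (auto simp: doubleton_eq_iff)
    then show ?thesis using uv(2) by simp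
  qed
  have finS: "finite S" unfolding S_def using finB e by (intro finite_PiE_dflt) auto
  have cardS: "card S = 2 ^ card B" unfolding S_def using finB e by (subst card_PiE_dflt) auto
  have Sne: "S \<noteq> {}" using cardS by auto
  have ne: "{(u, v). {u, v} = e} \<noteq> {}" if "e \<in> B" for e using e[OF that] by fastforce
  have "Pi_pmf B undefined (\<lambda>e. pmf_of_set {(u, v). {u, v} = e}) = pmf_of_set S"
    unfolding S_def using finB e ne by (intro Pi_pmf_of_set) auto
  then have "random_tournament F = map_pmf f (pmf_of_set S)"
    unfolding random_tournament_def f_def B_def by simp
  then have "measure_pmf.prob (random_tournament F) Q = card (S \<inter> f -` Q) / card S"
    using measure_pmf_of_set[OF Sne finS] by simp
  moreover have "card (S \<inter> f -` Q) \<le> card {G \<in> Q. pverts G = pverts F}"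
  proof (rule card_inj_on_le[OF _ _ fin])
    show "f ` (S \<inter> f -` Q) \<subseteq> {G \<in> Q. pverts G = pverts F}" by (auto simp: f_def)
    show "inj_on f (S \<inter> f -` Q)"
    proof (rule inj_onI)
      fix c d assume cd: "c \<in> S \<inter> f -` Q" "d \<in> S \<inter> f -` Q" "f c = f d"
      have ends: "{fst (g e), snd (g e)} = e" if "g \<in> S" "e \<in> B" for g e
        using that unfolding S_def PiE_dflt_def by (auto split: prod.splits)
      \<comment> \<open>The arcs over bidirectional pairs are exactly the chosen ones, so the choice
        function can be read off from the tournament.\<close>
      have arcs: "p \<in> parcs (f g) \<and> {fst p, snd p} \<in> B \<longleftrightarrow> p \<in> g ` B" if "g \<in> S" for g p
        using ends[OF that] by (cases p) (fastforce simp: f_def B_def[symmetric])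
      have "c e = d e" if "e \<in> B" for e
      proof -
        have "c e \<in> d ` B" using arcs[of c "c e"] arcs[of d "c e"] cd that by auto
        then obtain e' where "e' \<in> B" "c e = d e'" by blast
        then show ?thesis using ends[of c e] ends[of d e'] cd that by auto
      qed
      moreover have "c e = d e" if "e \<notin> B" for e using cd that by (auto simp: S_def PiE_dflt_def)
      ultimately show "c = d" by blast
    qed
  qed
  ultimately show ?thesis using cardS by (simp add: B_def divide_right_mono)
qed

text \<open>Expansion of singletons, which are small enough because \<open>card V \<ge> 2\<close>,
  gives minimum degree at least \<open>d\<close>; then count incidences.\<close>

lemma expander_card_edges:
  assumes V: "finite V" "card V \<ge> 2" and E: "finite E" "\<And>e. e \<in> E \<Longrightarrow> finite e \<and> card e \<le> 2"
    and exp: "is_expander d V E"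
  shows "real (card V) * d \<le> 2 * real (card E)"
proof -
  have "d \<le> real (card {e \<in> E. v \<in> e})" if v: "v \<in> V" for v
  proof -
    have "d * real (card {v}) \<le> real (card {e \<in> E. \<exists>u\<in>{v}. \<exists>w\<in>V - {v}. e = {u, w}})"
      using exp v V(2) unfolding is_expander_def by (elim allE[of _ "{v}"]) auto
    also have "\<dots> \<le> real (card {e \<in> E. v \<in> e})"
      using E(1) by (intro of_nat_mono card_mono) auto
    finally show ?thesis by simp
  qed
  then have "real (card V) * d \<le> (\<Sum>v\<in>V. real (card {e \<in> E. v \<in> e}))"
    using sum_bounded_below[of V d] by simp
  also have "\<dots> = real (\<Sum>v\<in>V. card {e \<in> E. v \<in> e})" by simp
  also have "(\<Sum>v\<in>V. card {e \<in> E. v \<in> e}) = (\<Sum>e\<in>E. card {v \<in> V. v \<in> e})"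
    using V(1) E(1) by (intro sum_multicount_gen) auto
  also have "\<dots> \<le> (\<Sum>e\<in>E. 2)"
  proof (rule sum_mono)
    fix e assume "e \<in> E"
    then have "finite e" "card e \<le> 2" using E(2) by blast+
    then show "card {v \<in> V. v \<in> e} \<le> 2"
      using card_mono[of e "{v \<in> V. v \<in> e}"] by (simp add: subset_iff)
  qed
  finally show ?thesis by simp
qed

text \<open>The constant 16 yields \<open>m \<ge> 8 * n * log 2 n\<close>, hence at least
  \<open>n ^ (8 * n)\<close> orientations, against at most \<open>2 * n ^ (5 * n)\<close> members of
  \<open>Q5\<close>.\<close>

lemma Q5_count_bound:
  assumes n: "n \<ge> (2::nat)" and m: "real n * (16 * log 2 (real n) powr 16) \<le> 2 * real m"
  shows "real (n ^ n + (3 * n ^ 3) ^ n) / 2 ^ m < 1 / 2"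
proof -
  have l: "log 2 (real n) \<ge> 1" using n by simp
  then have "log 2 (real n) powr 1 \<le> log 2 (real n) powr 16" by (intro powr_mono) auto
  then have "real n * (16 * log 2 (real n)) \<le> real n * (16 * log 2 (real n) powr 16)"
    using l by (intro mult_left_mono) auto
  then have m': "real (8 * n) * log 2 (real n) \<le> real m" using m by simp
  have "real n ^ (8 * n) = 2 powr (real (8 * n) * log 2 (real n))"
    using n by (simp add: powr_realpow[symmetric] powr_powr[symmetric] mult.commute[of _ "log 2 _"] del: of_nat_mult)
  also have "\<dots> \<le> 2 powr real m" using m' by simp
  finally have 1: "real (n ^ (8 * n)) \<le> 2 ^ m" by (simp add: powr_realpow)
  have 2: "n ^ n + (3 * n ^ 3) ^ n \<le> 2 * n ^ (5 * n)"
  proof -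
    have "3 \<le> n ^ 2" using power_mono[OF n, of 2] by simp
    then have "3 * n ^ 3 \<le> n ^ 2 * n ^ 3" by (rule mult_le_mono1)
    then have "(3 * n ^ 3) ^ n \<le> (n ^ 5) ^ n" by (intro power_mono) (simp_all flip: power_add)
    moreover have "n ^ n \<le> n ^ (5 * n)" using n by (intro power_increasing) auto
    ultimately show ?thesis by (simp add: power_mult)
  qed
  \<comment> \<open>One factor 2 comes from adding the two kinds of codes, the other from the
    probability 1/2; the surplus \<open>n ^ (3 * n)\<close> is at least 64.\<close>
  have 3: "4 * n ^ (5 * n) < n ^ (8 * n)"
  proof -
    have "(4::nat) < 2 ^ 6" by simp
    also have "(2::nat) ^ 6 \<le> n ^ 6" using n by (rule power_mono) simp
    also have "n ^ 6 \<le> n ^ (3 * n)" using n by (intro power_increasing) auto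
    finally have "4 * n ^ (5 * n) < n ^ (3 * n) * n ^ (5 * n)" using n by simp
    then show ?thesis by (simp flip: power_add)
  qed
  have "2 * x < z" if "x \<le> 2 * y" "4 * y < z" for x y z :: nat using that by linarith
  from this[OF 2 3] have "real (2 * (n ^ n + (3 * n ^ 3) ^ n)) < real (n ^ (8 * n))"
    by (rule of_nat_less_iff[THEN iffD2])
  also note 1
  finally have "2 * real (n ^ n + (3 * n ^ 3) ^ n) < 2 ^ m" by (simp only: of_nat_mult of_nat_numeral)
  moreover have "x / y < 1 / 2" if "2 * x < y" "0 < y" for x y :: real using that by (simp add: field_simps)
  ultimately show ?thesis by simp
qed

lemma sparse_Q5: "sparse_family (Q5 :: 'a pair_pre_digraph set)"
  unfolding sparse_family_def
proof (intro exI[of _ 16] allI impI, elim conjE)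
  fix n :: nat and F :: "'a pair_pre_digraph"
  assume n: "2 \<le> n" and F: "card (pverts F) = n" "semicomplete_expander (16 * log 2 (real n) powr 16) F"
  have pd: "pair_digraph F" and exp: "is_expander (16 * log 2 (real n) powr 16) (pverts F) (bidirectional_pairs F)"
    using F(2) unfolding semicomplete_expander_def semicomplete_def by blast+
  interpret pair_digraph F by (rule pd)
  have "finite e \<and> card e \<le> 2" if "e \<in> bidirectional_pairs F" for e
    using that unfolding bidirectional_pairs_def by (auto simp: card_insert_if)
  then have "real n * (16 * log 2 (real n) powr 16) \<le> 2 * real (card (bidirectional_pairs F))"
    using expander_card_edges[OF pair_finite_verts _ finite_bidirectional_pairs[OF pd] _ exp] n F(1) by blast
  then have *: "real (n ^ n + (3 * n ^ 3) ^ n) / 2 ^ card (bidirectional_pairs F) < 1 / 2"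
    using n by (intro Q5_count_bound)
  note Q = card_Q5_le[OF pair_finite_verts F(1)]
  have "measure_pmf.prob (random_tournament F) Q5
      \<le> real (card {G \<in> Q5. pverts G = pverts F}) / 2 ^ card (bidirectional_pairs F)"
    using pd Q(1) by (rule prob_random_tournament_le)
  also have "\<dots> \<le> real (n ^ n + (3 * n ^ 3) ^ n) / 2 ^ card (bidirectional_pairs F)"
    using Q(2) by (intro divide_right_mono of_nat_mono) simp_all
  finally show "measure_pmf.prob (random_tournament F) Q5 < 1 / 2" using * by linarith
qed

theorem theorem4:
  shows "sparse_family (Q5 :: nat pair_pre_digraph set) \<and>
    (\<exists>g \<in> O(\<lambda>_::nat. 1::real).
       \<forall>\<^sub>F n in sequentially. real (t_min n U5) = real n * log 2 (real n) powr g n)"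
  using sparse_Q5 t_min_U5_polylog by blast

end
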